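(* Let $T$ be a finite forest. If $T$ has no edges, then $\mathring{s}(T)=|V(T)|$. If $v$ is a stem in $T$ and $R$ is the set of leaf neighbors of $v$, with $r=|R|$, then \[ \mathring{s}(T) = \begin{cases} \mathring{s}(T-R-v)+r+1+u_r, & \text{if } r+1 \text{ is not a triangular number},\\ \mathring{s}(T-R)+r+u_r, & \text{if } r+1 \text{ is a triangular number.}\end{cases}\]
   Context: Slow-coloring game on a finite graph $G$: Lister and Painter alternate rounds. In each round Lister marks a nonempty set $M$ of currently uncolored vertices, scoring $|M|$ points; Painter then colors a subset of $M$ that is independent in $G$. The game ends when all vertices are colored. Painter wants to minimize the total score, Lister to maximize it. The sum-color cost $\mathring{s}(G)$ is the value of this game (the score each player can guarantee); equivalently $\mathring{s}$ of the graph with no vertices is $0$ and $\mathring{s}(G)=\max_{\emptyset\ne M\subseteq V(G)}\big(|M|+\min_I \mathring{s}(G-I)\big)$, the minimum over subsets $I\subseteq M$ independent in $G$. For integers $k\ge 0$ let $t_k=\binom{k+1}{2}$; a triangular number is $t_k$ for some $k\ge1$. For an integer $r\ge0$ let $u_r=\max\{k\ge 0: t_k\le r\}$. A leaf is a vertex of degree $1$. A stem in a forest is a vertex having a leaf neighbor and at most one non-leaf neighbor. $T-R-v$ denotes deleting the vertices of $R$ and $v$. *)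

theory Defs
  imports Complex_Main
begin

record 'a sgraph =
  verts :: "'a set"
  edges :: "'a set set"

definition finite_simple_graph :: "'a sgraph \<Rightarrow> bool" where
  "finite_simple_graph G \<longleftrightarrow>
     finite (verts G) \<and> (\<forall>e\<in>edges G. e \<subseteq> verts G \<and> card e = 2)"

definition delete_verts :: "'a sgraph \<Rightarrow> 'a set \<Rightarrow> 'a sgraph" where
  "delete_verts G S = \<lparr>verts = verts G - S, edges = {e \<in> edges G. e \<inter> S = {}}\<rparr>"

definition independent_in :: "'a sgraph \<Rightarrow> 'a set \<Rightarrow> bool" where
  "independent_in G I \<longleftrightarrow> (\<forall>x\<in>I. \<forall>y\<in>I. {x, y} \<notin> edges G)"

text \<open>A cycle is listed by its vertices, without repeating the first one at the end.\<close>

definition is_cycle :: "'a sgraph \<Rightarrow> 'a list \<Rightarrow> bool" where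
  "is_cycle G p \<longleftrightarrow> length p \<ge> 3 \<and> distinct p \<and>
     (\<forall>i < length p. {p ! i, p ! (Suc i mod length p)} \<in> edges G)"

definition finite_forest :: "'a sgraph \<Rightarrow> bool" where
  "finite_forest G \<longleftrightarrow> finite_simple_graph G \<and> (\<nexists>p. is_cycle G p)"

definition nbrs :: "'a sgraph \<Rightarrow> 'a \<Rightarrow> 'a set" where
  "nbrs G v = {w \<in> verts G. {v, w} \<in> edges G}"

definition is_leaf :: "'a sgraph \<Rightarrow> 'a \<Rightarrow> bool" where
  "is_leaf G v \<longleftrightarrow> v \<in> verts G \<and> card (nbrs G v) = 1"

definition leaf_nbrs :: "'a sgraph \<Rightarrow> 'a \<Rightarrow> 'a set" where
  "leaf_nbrs G v = {w \<in> nbrs G v. is_leaf G w}"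

definition is_stem :: "'a sgraph \<Rightarrow> 'a \<Rightarrow> bool" where
  "is_stem G v \<longleftrightarrow> v \<in> verts G \<and> leaf_nbrs G v \<noteq> {} \<and>
     card (nbrs G v - leaf_nbrs G v) \<le> 1"

definition tri :: "nat \<Rightarrow> nat" where
  "tri k = (k + 1) choose 2"

definition triangular :: "nat \<Rightarrow> bool" where
  "triangular n \<longleftrightarrow> (\<exists>k\<ge>1. n = tri k)"

definition tri_root :: "nat \<Rightarrow> nat" where
  "tri_root r = Max {k. tri k \<le> r}"

text \<open>
  The position of the game is the graph induced by the uncolored vertices.
  \<open>painter_guarantees G s\<close> says that from \<open>G\<close> Painter can bring the game to an end with total
  score at most \<open>s\<close>, and \<open>lister_guarantees G s\<close> says that Lister can score at least \<open>s\<close>.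
  Painter may color no vertex in a round; both definitions are nevertheless well-founded, as
  every round consumes a positive amount of \<open>s\<close>. The truncated subtraction in
  \<open>lister_guarantees\<close> is intended: once Lister has reached the target nothing is left to score.
\<close>

inductive painter_guarantees :: "'a sgraph \<Rightarrow> nat \<Rightarrow> bool" where
  finished: "verts G = {} \<Longrightarrow> painter_guarantees G s"
| round: "(\<And>M. M \<noteq> {} \<Longrightarrow> M \<subseteq> verts G \<Longrightarrow>
      card M \<le> s \<and>
      (\<exists>I. I \<subseteq> M \<and> independent_in G I \<and>
           painter_guarantees (delete_verts G I) (s - card M)))
    \<Longrightarrow> painter_guarantees G s"

inductive lister_guarantees :: "'a sgraph \<Rightarrow> nat \<Rightarrow> bool" where
  nothing: "lister_guarantees G 0"
| mark: "M \<noteq> {} \<Longrightarrow> M \<subseteq> verts G \<Longrightarrow>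
    (\<And>I. I \<subseteq> M \<Longrightarrow> independent_in G I \<Longrightarrow>
        lister_guarantees (delete_verts G I) (s - card M))
    \<Longrightarrow> lister_guarantees G s"

definition sum_color_cost :: "'a sgraph \<Rightarrow> nat" where
  "sum_color_cost G = (THE s. painter_guarantees G s \<and> lister_guarantees G s)"

lemma verts_delete_verts [simp]: "verts (delete_verts G S) = verts G - S"
  by (simp add: delete_verts_def)

lemma finite_simple_graph_delete_verts:
  "finite_simple_graph G \<Longrightarrow> finite_simple_graph (delete_verts G S)"
  by (auto simp: finite_simple_graph_def delete_verts_def)

lemma independent_in_singleton:
  "finite_simple_graph G \<Longrightarrow> independent_in G {x}"
  by (auto simp: finite_simple_graph_def independent_in_def)

lemma painter_guarantees_mono:
  assumes "painter_guarantees G s" "s \<le> s'"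
  shows "painter_guarantees G s'"
  using assms
proof (induction arbitrary: s' rule: painter_guarantees.induct)
  case (finished G s)
  then show ?case by (auto intro: painter_guarantees.finished)
next
  case (round G s)
  show ?case
  proof (rule painter_guarantees.round)
    fix M assume M: "M \<noteq> {}" "M \<subseteq> verts G"
    from round.IH[OF M] obtain I where I: "card M \<le> s" "I \<subseteq> M" "independent_in G I"
      "\<forall>x\<ge>s - card M. painter_guarantees (delete_verts G I) x" by auto
    then have "painter_guarantees (delete_verts G I) (s' - card M)"
      using round.prems by (simp add: diff_le_mono)
    then show "card M \<le> s' \<and> (\<exists>I\<subseteq>M. independent_in G I \<and>
        painter_guarantees (delete_verts G I) (s' - card M))"
      using I round.prems by auto
  qed
qed

lemma lister_le_painter:
  assumes "painter_guarantees G s" "lister_guarantees G s'"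
  shows "s' \<le> s"
  using assms
proof (induction arbitrary: s' rule: painter_guarantees.induct)
  case (finished G s)
  then show ?case by (auto elim: lister_guarantees.cases)
next
  case (round G s)
  from round.prems show ?case
  proof (cases rule: lister_guarantees.cases)
    case nothing
    then show ?thesis by simp
  next
    case (mark M)
    with round.IH[of M] obtain I where I: "card M \<le> s" "I \<subseteq> M" "independent_in G I"
      "\<forall>x. lister_guarantees (delete_verts G I) x \<longrightarrow> x \<le> s - card M" by auto
    with mark have "s' - card M \<le> s - card M" by blast
    with I show ?thesis by linarith
  qed
qed

lemma painter_or_lister:
  assumes "finite (verts G)" "\<not> painter_guarantees G s"
  shows "lister_guarantees G (Suc s)"
  using assms
proof (induction s arbitrary: G rule: less_induct)
  case (less s)
  have "\<exists>M. M \<noteq> {} \<and> M \<subseteq> verts G \<and> \<not> (card M \<le> s \<and> (\<exists>I\<subseteq>M. independent_in G I \<and>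
          painter_guarantees (delete_verts G I) (s - card M)))"
  proof (rule ccontr)
    assume "\<not> ?thesis"
    then have "painter_guarantees G s"
      by (intro painter_guarantees.round) metis
    with less.prems(2) show False ..
  qed
  then obtain M where M: "M \<noteq> {}" "M \<subseteq> verts G" and
    *: "\<not> (card M \<le> s \<and> (\<exists>I\<subseteq>M. independent_in G I \<and>
          painter_guarantees (delete_verts G I) (s - card M)))"
    by metis
  have pos: "card M > 0"
    using M less.prems(1) by (meson card_gt_0_iff finite_subset)
  show ?case
  proof (rule lister_guarantees.mark[OF M])
    fix I assume I: "I \<subseteq> M" "independent_in G I"
    show "lister_guarantees (delete_verts G I) (Suc s - card M)"
    proof (cases "card M \<le> s")
      case True
      then have "\<not> painter_guarantees (delete_verts G I) (s - card M)"
        using * I by blast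
      moreover have "s - card M < s" using True pos by linarith
      ultimately have "lister_guarantees (delete_verts G I) (Suc (s - card M))"
        using less.IH less.prems(1) by simp
      then show ?thesis using True by (simp add: Suc_diff_le)
    next
      case False
      then have "Suc s - card M = 0" by simp
      then show ?thesis by (simp add: lister_guarantees.nothing)
    qed
  qed
qed

lemma painter_guarantees_bound:
  assumes "finite_simple_graph G"
  shows "painter_guarantees G (card (verts G) * card (verts G))"
  using assms
proof (induction "card (verts G)" arbitrary: G rule: less_induct)
  case less
  let ?n = "card (verts G)"
  have fin: "finite (verts G)" using less.prems by (simp add: finite_simple_graph_def)
  show ?case
  proof (rule painter_guarantees.round)
    fix M assume M: "M \<noteq> {}" "M \<subseteq> verts G"
    then obtain x where x: "x \<in> M" by blast
    have Mn: "card M \<le> ?n" using M fin by (simp add: card_mono)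
    have c: "card (verts (delete_verts G {x})) = ?n - 1"
      using x M fin by (simp add: subset_iff)
    have n: "?n > 0" using x M fin card_gt_0_iff by blast
    then obtain m where m: "?n = Suc m" using gr0_implies_Suc by blast
    have "painter_guarantees (delete_verts G {x}) ((?n - 1) * (?n - 1))"
      using less.hyps[of "delete_verts G {x}"] c n
        finite_simple_graph_delete_verts[OF less.prems] by simp
    moreover have "(?n - 1) * (?n - 1) \<le> ?n * ?n - card M"
      using Mn m by simp
    ultimately have "painter_guarantees (delete_verts G {x}) (?n * ?n - card M)"
      by (rule painter_guarantees_mono)
    moreover have "card M \<le> ?n * ?n" using Mn le_square le_trans by blast
    ultimately show "card M \<le> ?n * ?n \<and> (\<exists>I\<subseteq>M. independent_in G I \<and>
        painter_guarantees (delete_verts G I) (?n * ?n - card M))"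
      using x independent_in_singleton[OF less.prems] by blast
  qed
qed

lemma sum_color_cost_unique:
  assumes "finite_simple_graph G"
  shows "\<exists>!s. painter_guarantees G s \<and> lister_guarantees G s"
proof -
  define s where "s = (LEAST s. painter_guarantees G s)"
  have P: "painter_guarantees G s"
    unfolding s_def using painter_guarantees_bound[OF assms] by (rule LeastI)
  have "lister_guarantees G s"
  proof (cases s)
    case 0
    then show ?thesis by (simp add: lister_guarantees.nothing)
  next
    case (Suc m)
    then have "\<not> painter_guarantees G m"
      using not_less_Least[of m "painter_guarantees G"] by (simp add: s_def)
    then show ?thesis
      using painter_or_lister[of G m] Suc assms by (simp add: finite_simple_graph_def)
  qed
  with P show ?thesis by (intro ex1I[of _ s]) (auto intro: antisym lister_le_painter)
qed

lemma sum_color_cost_guarantees: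
  assumes "finite_simple_graph G"
  shows "painter_guarantees G (sum_color_cost G)" "lister_guarantees G (sum_color_cost G)"
  using theI'[OF sum_color_cost_unique[OF assms]] by (simp_all add: sum_color_cost_def)

lemma painter_guarantees_iff:
  assumes "finite_simple_graph G"
  shows "painter_guarantees G s \<longleftrightarrow> sum_color_cost G \<le> s"
  using sum_color_cost_guarantees[OF assms] painter_guarantees_mono lister_le_painter by blast

lemma sum_color_cost_empty:
  "verts G = {} \<Longrightarrow> finite_simple_graph G \<Longrightarrow> sum_color_cost G = 0"
  using painter_guarantees.finished[of G 0] painter_guarantees_iff[of G 0] by simp

lemma sum_color_cost_rec:
  assumes G: "finite_simple_graph G" and ne: "verts G \<noteq> {}"
  shows "sum_color_cost G =
    (MAX M \<in> {M. M \<noteq> {} \<and> M \<subseteq> verts G}.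
       card M + (MIN I \<in> {I. I \<subseteq> M \<and> independent_in G I}. sum_color_cost (delete_verts G I)))"
    (is "_ = (MAX M \<in> ?Ms. ?f M)")
proof -
  have fin: "finite (verts G)" using G by (simp add: finite_simple_graph_def)
  have Ms: "finite ?Ms" "?Ms \<noteq> {}"
    using fin ne by auto
  have Is: "finite {I. I \<subseteq> M \<and> independent_in G I}" "{I. I \<subseteq> M \<and> independent_in G I} \<noteq> {}"
    if "M \<subseteq> verts G" for M
  proof -
    show "finite {I. I \<subseteq> M \<and> independent_in G I}"
      using finite_subset[OF that fin] by simp
    have "independent_in G {}" by (simp add: independent_in_def)
    then show "{I. I \<subseteq> M \<and> independent_in G I} \<noteq> {}" by blast
  qed
  have step: "painter_guarantees G s \<longleftrightarrow> (\<forall>M\<in>?Ms. card M \<le> s \<and>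
      (\<exists>I\<subseteq>M. independent_in G I \<and> painter_guarantees (delete_verts G I) (s - card M)))" for s
  proof
    assume "painter_guarantees G s"
    then show "\<forall>M\<in>?Ms. card M \<le> s \<and>
      (\<exists>I\<subseteq>M. independent_in G I \<and> painter_guarantees (delete_verts G I) (s - card M))"
      by (cases rule: painter_guarantees.cases) (use ne in simp_all)
  next
    assume R: "\<forall>M\<in>?Ms. card M \<le> s \<and>
      (\<exists>I\<subseteq>M. independent_in G I \<and> painter_guarantees (delete_verts G I) (s - card M))"
    show "painter_guarantees G s"
    proof (rule painter_guarantees.round)
      fix M assume "M \<noteq> {}" "M \<subseteq> verts G"
      then have "M \<in> ?Ms" by simp
      with R show "card M \<le> s \<and> (\<exists>I\<subseteq>M. independent_in G I \<and>
        painter_guarantees (delete_verts G I) (s - card M))" by (rule bspec)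
    qed
  qed
  have "sum_color_cost G \<le> s \<longleftrightarrow> (MAX M \<in> ?Ms. ?f M) \<le> s" for s
  proof -
    have "sum_color_cost G \<le> s \<longleftrightarrow> (\<forall>M\<in>?Ms. card M \<le> s \<and>
      (\<exists>I\<subseteq>M. independent_in G I \<and> sum_color_cost (delete_verts G I) \<le> s - card M))"
      using step[of s] painter_guarantees_iff[OF G]
        painter_guarantees_iff[OF finite_simple_graph_delete_verts[OF G]] by simp
    also have "\<dots> \<longleftrightarrow> (\<forall>M\<in>?Ms. ?f M \<le> s)"
    proof (rule ball_cong[OF refl])
      fix M assume "M \<in> ?Ms"
      then have M: "M \<subseteq> verts G" by simp
      let ?m = "MIN I \<in> {I. I \<subseteq> M \<and> independent_in G I}. sum_color_cost (delete_verts G I)"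
      have *: "?m \<le> t \<longleftrightarrow> (\<exists>I\<subseteq>M. independent_in G I \<and> sum_color_cost (delete_verts G I) \<le> t)" for t
        using Is[OF M] by (subst Min_le_iff) auto
      have "(card M \<le> s \<and>
        (\<exists>I\<subseteq>M. independent_in G I \<and> sum_color_cost (delete_verts G I) \<le> s - card M))
        \<longleftrightarrow> card M \<le> s \<and> ?m \<le> s - card M"
        by (simp only: *)
      also have "\<dots> \<longleftrightarrow> ?f M \<le> s" by linarith
      finally show "(card M \<le> s \<and>
        (\<exists>I\<subseteq>M. independent_in G I \<and> sum_color_cost (delete_verts G I) \<le> s - card M))
        \<longleftrightarrow> ?f M \<le> s" .
    qed
    also have "\<dots> \<longleftrightarrow> (MAX M \<in> ?Ms. ?f M) \<le> s"
      using Ms by (subst Max_le_iff) auto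
    finally show ?thesis .
  qed
  from this[of "sum_color_cost G"] this[of "MAX M \<in> ?Ms. ?f M"] show ?thesis
    by (intro antisym) simp_all
qed

end

theory Submission
  imports Defs
begin

text \<open>
  Let \<open>v\<close> carry a set \<open>R\<close> of \<open>r\<close> leaves and have at most one further neighbor \<open>w\<close>. Deleting the
  vertex \<open>v\<close> of degree at most 1 from \<open>F = T - R\<close> lowers the cost by 1 or 2, say by \<open>1 + d\<close>, and both
  cases of the theorem say that the cost of \<open>T\<close> is \<open>s(F - v) + r + 1 + k\<close> with
  \<open>k = tri_root (r + d)\<close>. Lister achieves this without ever playing on \<open>F - v\<close>, by marking \<open>v\<close> and
  \<open>k\<close> leaves until \<open>v\<close> is colored. Painter answers a mark in \<open>F\<close> as in an optimal game on \<open>F\<close> or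
  \<open>F - v\<close>, colors all marked leaves while \<open>v\<close> stays uncolored, and colors \<open>v\<close> only when it is marked
  with at most \<open>k\<close> leaves.
\<close>

section \<open>Triangular numbers\<close>

lemma tri_0 [simp]: "tri 0 = 0"
  by (simp add: tri_def)

lemma tri_Suc [simp]: "tri (Suc k) = tri k + Suc k"
  by (simp add: tri_def numeral_2_eq_2)

lemma strict_mono_tri: "strict_mono tri"
  by (simp add: strict_mono_Suc_iff)

text \<open>A Galois connection: \<open>tri_root\<close> is the upper adjoint of \<open>tri\<close>.
  The set under \<open>Max\<close> is finite because k \<le> \<open>tri k\<close>. The later facts
  about \<open>tri_root\<close> rest on this equivalence, not on \<open>Max\<close>.\<close>

lemma le_tri_root_iff: "k \<le> tri_root n \<longleftrightarrow> tri k \<le> n"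
proof -
  have "k \<le> tri k" for k by (induction k) auto
  then have "{k. tri k \<le> n} \<subseteq> {..n}" by (auto intro: le_trans)
  then have fin: "finite {k. tri k \<le> n}" by (rule finite_subset) simp
  have "tri 0 \<le> n" by simp
  then have "tri (tri_root n) \<le> n"
    using Max_in[OF fin] unfolding tri_root_def by blast
  then show ?thesis
    using Max_ge[OF fin, of k] strict_mono_less_eq[OF strict_mono_tri]
    unfolding tri_root_def by (meson le_trans mem_Collect_eq)
qed

lemma tri_root_mono: "m \<le> n \<Longrightarrow> tri_root m \<le> tri_root n"
  using le_tri_root_iff le_trans by blast

lemma tri_root_0 [simp]: "tri_root 0 = 0"
  using le_tri_root_iff[of "Suc 0" 0] by simp

lemma tri_root_1 [simp]: "tri_root (Suc 0) = Suc 0"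
  using le_tri_root_iff[of "Suc 0" "Suc 0"] le_tri_root_iff[of "Suc (Suc 0)" "Suc 0"] by simp

lemma tri_root_Suc_le: "tri_root (Suc n) \<le> Suc (tri_root n)"
  using le_tri_root_iff[of "tri_root (Suc n) - 1" n] le_tri_root_iff[of "tri_root (Suc n)" "Suc n"]
  by (cases "tri_root (Suc n)") auto

text \<open>With k = \<open>tri_root n\<close>, taking k away from n leaves at least
  \<open>tri k\<close> - k = \<open>tri (k - 1)\<close>. For Lister this means that coloring at most
  k leaves lowers the root by at most 1.\<close>

lemma tri_root_diff_ge: "tri_root n \<le> Suc (tri_root (n - tri_root n))"
proof (cases "tri_root n")
  case (Suc j)
  then have "tri j \<le> n - tri_root n"
    using le_tri_root_iff[of "Suc j" n] by simp
  then show ?thesis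
    using le_tri_root_iff Suc by simp
qed simp

text \<open>With k = \<open>tri_root n\<close>, n is less than \<open>tri k\<close> + k + 1, so
  taking away more than k leaves less than \<open>tri k\<close>. For Painter this means that
  coloring more than k leaves makes the root drop, which pays for leaving a marked center
  uncolored.\<close>

lemma tri_root_diff_less:
  assumes "tri_root n < l" "l \<le> n"
  shows "tri_root (n - l) < tri_root n"
proof -
  have "n < tri (tri_root n) + Suc (tri_root n)"
    using le_tri_root_iff[of "Suc (tri_root n)" n] by simp
  then show ?thesis
    using assms le_tri_root_iff[of "tri_root n" "n - l"] by linarith
qed

text \<open>This translates the root at r + 1, which occurs when the excess is 1, into the case
  distinction of the theorem.\<close>

lemma tri_root_Suc:
  "tri_root (Suc n) = (if triangular (Suc n) then Suc (tri_root n) else tri_root n)"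
proof -
  let ?k = "tri_root (Suc n)"
  have k: "tri ?k \<le> Suc n" "Suc n < tri (Suc ?k)"
    using le_tri_root_iff[of ?k "Suc n"] le_tri_root_iff[of "Suc ?k" "Suc n"] by simp_all
  have tr: "triangular (Suc n) \<longleftrightarrow> Suc n = tri ?k"
  proof
    assume "triangular (Suc n)"
    then obtain j where j: "Suc n = tri j" unfolding triangular_def by blast
    then have "j \<le> ?k" using le_tri_root_iff[of j "Suc n"] by simp
    then have "tri j \<le> tri ?k" using strict_mono_less_eq[OF strict_mono_tri] by blast
    then show "Suc n = tri ?k" using j k by simp
  next
    assume "Suc n = tri ?k"
    moreover from this have "?k \<ge> 1" by (cases ?k) (auto simp del: tri_Suc)
    ultimately show "triangular (Suc n)" unfolding triangular_def by blast
  qed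
  have "?k \<le> tri_root n \<longleftrightarrow> Suc n \<noteq> tri ?k"
    using le_tri_root_iff[of ?k n] k by linarith
  moreover have "tri_root n \<le> ?k" by (simp add: tri_root_mono)
  ultimately show ?thesis
    using tr tri_root_Suc_le[of n] by auto
qed

section \<open>Strategies for the slow-coloring game\<close>

lemma delete_verts_empty [simp]: "delete_verts G {} = G"
  by (simp add: delete_verts_def)

lemma delete_verts_delete_verts [simp]:
  "delete_verts (delete_verts G A) B = delete_verts G (A \<union> B)"
  by (auto simp: delete_verts_def)

lemma edges_delete_verts: "e \<in> edges (delete_verts G S) \<longleftrightarrow> e \<in> edges G \<and> e \<inter> S = {}"
  by (simp add: delete_verts_def)

lemma independent_in_delete_verts:
  "I \<inter> S = {} \<Longrightarrow> independent_in (delete_verts G S) I \<longleftrightarrow> independent_in G I"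
  by (auto simp: independent_in_def edges_delete_verts)

text \<open>One round of optimal play by Painter. The set \<open>M\<close> may be empty, so that the
  response can be consulted on whatever part of a marked set lies in a subgraph.\<close>

lemma optimal_response:
  assumes "finite_simple_graph G" "M \<subseteq> verts G"
  obtains I where "I \<subseteq> M" "independent_in G I"
    "card M + sum_color_cost (delete_verts G I) \<le> sum_color_cost G"
proof (cases "M = {}")
  case True
  then show ?thesis by (intro that[of "{}"]) (auto simp: independent_in_def)
next
  case False
  from sum_color_cost_guarantees(1)[OF assms(1)] show ?thesis
  proof (cases rule: painter_guarantees.cases)
    case finished
    then show ?thesis using False assms(2) by simp
  next
    case round
    from round[OF False assms(2)] show ?thesis
      using that painter_guarantees_iff[OF finite_simple_graph_delete_verts[OF assms(1)]]
      by (metis Nat.le_diff_conv2 add.commute)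
  qed
qed

text \<open>A strategy principle for Painter: \<open>P\<close> is an invariant and \<open>f\<close>
  a potential that pays for each round. Painter either stays inside \<open>P\<close> or leaves it
  for a position whose true cost is covered. The induction is on the potential, which drops because
  \<open>M\<close> is nonempty, even if no vertex is colored.\<close>

lemma sum_color_cost_le_potential:
  assumes "P G"
    and fsg: "\<And>G. P G \<Longrightarrow> finite_simple_graph G"
    and step: "\<And>G M. P G \<Longrightarrow> M \<noteq> {} \<Longrightarrow> M \<subseteq> verts G \<Longrightarrow>
      \<exists>I\<subseteq>M. independent_in G I \<and>
        (card M + sum_color_cost (delete_verts G I) \<le> f G \<or>
         P (delete_verts G I) \<and> card M + f (delete_verts G I) \<le> f G)"
  shows "sum_color_cost G \<le> f G"
  using assms(1)
proof (induction "f G" arbitrary: G rule: less_induct)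
  case less
  note fs = fsg[OF less.prems]
  have "painter_guarantees G (f G)"
  proof (rule painter_guarantees.round)
    fix M assume M: "M \<noteq> {}" "M \<subseteq> verts G"
    then have "card M > 0"
      using fs by (meson card_gt_0_iff finite_simple_graph_def finite_subset)
    obtain I where "I \<subseteq> M" "independent_in G I"
      and I: "card M + sum_color_cost (delete_verts G I) \<le> f G \<or>
        P (delete_verts G I) \<and> card M + f (delete_verts G I) \<le> f G"
      using step[OF less.prems M] by blast
    moreover have "card M + sum_color_cost (delete_verts G I) \<le> f G"
      using I less.hyps[of "delete_verts G I"] \<open>card M > 0\<close> by linarith
    ultimately show "card M \<le> f G \<and> (\<exists>I\<subseteq>M. independent_in G I \<and>
        painter_guarantees (delete_verts G I) (f G - card M))"
      using painter_guarantees_iff[OF finite_simple_graph_delete_verts[OF fs]]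
      by (intro conjI exI[of _ I]) auto
  qed
  then show ?case using painter_guarantees_iff[OF fs] by simp
qed

section \<open>Costs of isolated and pendant vertices\<close>

lemma sum_color_cost_delete_vertex:
  assumes "finite_simple_graph G" "x \<in> verts G"
  shows "Suc (sum_color_cost (delete_verts G {x})) \<le> sum_color_cost G"
proof -
  obtain I where I: "I \<subseteq> {x}" "card {x} + sum_color_cost (delete_verts G I) \<le> sum_color_cost G"
    using optimal_response[OF assms(1), of "{x}"] assms(2) by blast
  then have "I = {x}" by (cases "I = {}") auto
  with I show ?thesis by simp
qed

lemma independent_in_insert:
  assumes "finite_simple_graph G" "independent_in G I" "\<And>y. y \<in> I \<Longrightarrow> {x, y} \<notin> edges G"
  shows "independent_in G (insert x I)"
proof -
  have "{x} \<notin> edges G" using assms(1) by (auto simp: finite_simple_graph_def)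
  then show ?thesis
    using assms(2,3) by (auto simp: independent_in_def insert_commute)
qed

text \<open>For the upper bound, Painter plays optimally on the rest and colors \<open>x\<close> the
  first time it is marked, so \<open>x\<close> contributes one point.\<close>

lemma sum_color_cost_isolated_vertex:
  assumes "finite_simple_graph G" "x \<in> verts G" "\<And>y. {x, y} \<notin> edges G"
  shows "sum_color_cost G = Suc (sum_color_cost (delete_verts G {x}))"
proof (rule antisym)
  let ?P = "\<lambda>G. finite_simple_graph G \<and> x \<in> verts G \<and> (\<forall>y. {x, y} \<notin> edges G)"
  show "sum_color_cost G \<le> Suc (sum_color_cost (delete_verts G {x}))"
  proof (rule sum_color_cost_le_potential[where P = ?P])
    fix G M assume P: "?P G" and M: "M \<noteq> {}" "M \<subseteq> verts G"
    define A where "A = M - {x}"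
    have "finite M" using P M by (meson finite_simple_graph_def finite_subset)
    then have cM: "card M = card A + (if x \<in> M then 1 else 0)"
      using card_Suc_Diff1[of M x] by (simp add: A_def del: card_Diff_insert)
    obtain I where I: "I \<subseteq> A" "independent_in (delete_verts G {x}) I"
      "card A + sum_color_cost (delete_verts (delete_verts G {x}) I)
        \<le> sum_color_cost (delete_verts G {x})"
      using optimal_response[of "delete_verts G {x}" A] P M A_def
        finite_simple_graph_delete_verts by (metis Diff_mono order_refl verts_delete_verts)
    have ind: "independent_in G I" using I A_def by (subst (asm) independent_in_delete_verts) auto
    show "\<exists>I\<subseteq>M. independent_in G I \<and>
        (card M + sum_color_cost (delete_verts G I) \<le> Suc (sum_color_cost (delete_verts G {x})) \<or>
         ?P (delete_verts G I) \<and> card M + Suc (sum_color_cost (delete_verts (delete_verts G I) {x}))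
           \<le> Suc (sum_color_cost (delete_verts G {x})))"
    proof (cases "x \<in> M")
      case True
      have "independent_in G (insert x I)" using P ind by (intro independent_in_insert) auto
      moreover have "insert x I \<subseteq> M" using I(1) True A_def by blast
      ultimately show ?thesis using I(3) True cM by (intro exI[of _ "insert x I"]) simp
    next
      case False
      have "?P (delete_verts G I)"
        using P I(1) A_def by (auto simp: finite_simple_graph_delete_verts edges_delete_verts)
      moreover have "I \<subseteq> M" using I(1) A_def by blast
      ultimately show ?thesis using I(3) cM ind False by (intro exI[of _ I]) simp
    qed
  qed (use assms in auto)
qed (rule sum_color_cost_delete_vertex[OF assms(1,2)])

text \<open>The vertices are peeled off one by one. Only \<open>S \<inter> verts G\<close> is
  counted because the leaf set is kept fixed while some of its members are already colored.\<close>

lemma sum_color_cost_isolated_vertices: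
  assumes "finite_simple_graph G" "\<And>x y. x \<in> S \<Longrightarrow> {x, y} \<notin> edges G"
  shows "sum_color_cost G = sum_color_cost (delete_verts G S) + card (S \<inter> verts G)"
proof -
  have "finite (S \<inter> verts G)" using assms(1) by (simp add: finite_simple_graph_def)
  moreover have "sum_color_cost G = sum_color_cost (delete_verts G X) + card X"
    if "finite X" "X \<subseteq> S \<inter> verts G" for X
    using that
  proof (induction X)
    case (insert x X)
    have "sum_color_cost (delete_verts G X) = Suc (sum_color_cost (delete_verts G (insert x X)))"
      using sum_color_cost_isolated_vertex[of "delete_verts G X" x] insert assms
      by (simp add: finite_simple_graph_delete_verts edges_delete_verts)
    then show ?case using insert by simp
  qed simp
  moreover have "delete_verts G (S \<inter> verts G) = delete_verts G S"
    using assms(1) by (auto simp: delete_verts_def finite_simple_graph_def)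
  ultimately show ?thesis by (metis order_refl)
qed

text \<open>Painter plays optimally on the graph without \<open>v\<close> and adds \<open>v\<close>
  to the answer when it is marked. If the answer contains \<open>w\<close>, this is impossible, but
  then \<open>v\<close> becomes isolated and costs just one more point.\<close>

lemma sum_color_cost_pendant_vertex:
  assumes "finite_simple_graph G" "v \<in> verts G" "\<And>y. {v, y} \<in> edges G \<Longrightarrow> y = w"
  shows "sum_color_cost G \<le> sum_color_cost (delete_verts G {v}) + 2"
proof (rule sum_color_cost_le_potential[where
      P = "\<lambda>G. finite_simple_graph G \<and> v \<in> verts G \<and> (\<forall>y. {v, y} \<in> edges G \<longrightarrow> y = w)"])
  let ?P = "\<lambda>G. finite_simple_graph G \<and> v \<in> verts G \<and> (\<forall>y. {v, y} \<in> edges G \<longrightarrow> y = w)"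
  fix G M assume P: "?P G" and M: "M \<noteq> {}" "M \<subseteq> verts G"
  define A where "A = M - {v}"
  have "finite M" using P M by (meson finite_simple_graph_def finite_subset)
  then have cM: "card M = card A + (if v \<in> M then 1 else 0)"
    using card_Suc_Diff1[of M v] by (simp add: A_def del: card_Diff_insert)
  obtain I where I: "I \<subseteq> A" "independent_in (delete_verts G {v}) I"
    "card A + sum_color_cost (delete_verts (delete_verts G {v}) I)
      \<le> sum_color_cost (delete_verts G {v})"
    using optimal_response[of "delete_verts G {v}" A] P M A_def
      finite_simple_graph_delete_verts by (metis Diff_mono order_refl verts_delete_verts)
  have ind: "independent_in G I" using I A_def by (subst (asm) independent_in_delete_verts) auto
  show "\<exists>I\<subseteq>M. independent_in G I \<and>
      (card M + sum_color_cost (delete_verts G I) \<le> sum_color_cost (delete_verts G {v}) + 2 \<or>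
       ?P (delete_verts G I) \<and> card M + (sum_color_cost (delete_verts (delete_verts G I) {v}) + 2)
         \<le> sum_color_cost (delete_verts G {v}) + 2)"
  proof (cases "v \<in> M")
    case True
    show ?thesis
    proof (cases "w \<in> I")
      case True
      have "sum_color_cost (delete_verts G I) = Suc (sum_color_cost (delete_verts (delete_verts G I) {v}))"
        using P I(1) True A_def
        by (intro sum_color_cost_isolated_vertex)
          (auto simp: finite_simple_graph_delete_verts edges_delete_verts)
      moreover have "I \<subseteq> M" using I(1) A_def by blast
      ultimately show ?thesis using I(3) cM ind \<open>v \<in> M\<close> by (intro exI[of _ I]) simp
    next
      case False
      have "independent_in G (insert v I)" using P ind False by (intro independent_in_insert) auto
      moreover have "insert v I \<subseteq> M" using I(1) True A_def by blast
      ultimately show ?thesis using I(3) True cM by (intro exI[of _ "insert v I"]) simp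
    qed
  next
    case False
    have "?P (delete_verts G I)"
      using P I(1) A_def by (auto simp: finite_simple_graph_delete_verts edges_delete_verts)
    moreover have "I \<subseteq> M" using I(1) A_def by blast
    ultimately show ?thesis using I(3) cM ind False by (intro exI[of _ I]) simp
  qed
qed (use assms in auto)

section \<open>Stars hanging from a graph\<close>

text \<open>Neither \<open>R\<close> nor \<open>w\<close> is tied to \<open>verts G\<close>, so the
  predicate persists with the same parameters when leaves or \<open>w\<close> get colored. A value
  \<open>w\<close> outside the graph stands for the absence of a further neighbor.\<close>

definition pendant_star :: "'a sgraph \<Rightarrow> 'a \<Rightarrow> 'a set \<Rightarrow> 'a \<Rightarrow> bool" where
  "pendant_star G v R w \<longleftrightarrow> finite_simple_graph G \<and> v \<in> verts G \<and> v \<notin> R \<and>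
     (\<forall>x\<in>R. \<forall>y. {x, y} \<in> edges G \<longrightarrow> y = v) \<and> (\<forall>y. {v, y} \<in> edges G \<longrightarrow> y \<in> R \<or> y = w)"

text \<open>The number d of the overview. For a pendant star the truncated subtraction is exact,
  since deleting \<open>v\<close> lowers the cost by at least 1.\<close>

definition excess :: "'a sgraph \<Rightarrow> 'a \<Rightarrow> 'a set \<Rightarrow> nat" where
  "excess G v R =
     sum_color_cost (delete_verts G R) - Suc (sum_color_cost (delete_verts G (insert v R)))"

definition star_value :: "'a sgraph \<Rightarrow> 'a \<Rightarrow> 'a set \<Rightarrow> nat" where
  "star_value G v R = sum_color_cost (delete_verts G (insert v R)) +
     card (R \<inter> verts G) + 1 + tri_root (card (R \<inter> verts G) + excess G v R)"

lemma pendant_star_delete_verts: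
  "pendant_star G v R w \<Longrightarrow> v \<notin> I \<Longrightarrow> pendant_star (delete_verts G I) v R w"
  by (auto simp: pendant_star_def finite_simple_graph_delete_verts edges_delete_verts)

text \<open>Without \<open>R\<close>, the vertex \<open>v\<close> has no neighbor but
  \<open>w\<close>, so the bounds for pendant vertices apply; once \<open>w\<close> is gone,
  \<open>v\<close> is isolated and its deletion lowers the cost by exactly 1.\<close>

lemma pendant_star_costs:
  assumes "pendant_star G v R w"
  shows "sum_color_cost (delete_verts G R)
      = Suc (sum_color_cost (delete_verts G (insert v R)) + excess G v R)"
    and "excess G v R \<le> 1"
    and "w \<notin> verts G \<Longrightarrow> excess G v R = 0"
proof -
  let ?F = "delete_verts G R"
  have F: "finite_simple_graph ?F" "v \<in> verts ?F" "\<And>y. {v, y} \<in> edges ?F \<Longrightarrow> y = w"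
    using assms by (auto simp: pendant_star_def finite_simple_graph_delete_verts edges_delete_verts)
  show *: "sum_color_cost ?F = Suc (sum_color_cost (delete_verts G (insert v R)) + excess G v R)"
    using sum_color_cost_delete_vertex[OF F(1,2)] by (simp add: excess_def)
  show "excess G v R \<le> 1"
    using sum_color_cost_pendant_vertex[OF F] * by simp
  show "excess G v R = 0" if "w \<notin> verts G"
  proof -
    have "{v, y} \<notin> edges ?F" for y
      using F(1) F(3)[of y] that by (auto simp: finite_simple_graph_def)
    then have "sum_color_cost ?F = Suc (sum_color_cost (delete_verts ?F {v}))"
      by (rule sum_color_cost_isolated_vertex[OF F(1,2)])
    then show ?thesis by (simp add: excess_def)
  qed
qed

text \<open>Painter's answer to one round. With \<open>b\<close> the cost without star and center,
  and l marked leaves, two kinds of answer compete. Coloring \<open>v\<close> along with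
  \<open>I\<close> is affordable if \<open>card A + b I + l \<le> b {} + k\<close>. Coloring all
  marked leaves but not \<open>v\<close> is affordable if
  \<open>card A + b I + tri_root (r - l + d I)\<close>, plus 1 when \<open>v\<close> is marked, is
  at most \<open>b {} + k\<close>.\<close>

lemma star_value_response:
  assumes S: "pendant_star G v R w" and M: "M \<subseteq> verts G"
  shows "\<exists>I\<subseteq>M. independent_in G I \<and>
    (card M + sum_color_cost (delete_verts G I) \<le> star_value G v R \<or>
     pendant_star (delete_verts G I) v R w \<and>
       card M + star_value (delete_verts G I) v R \<le> star_value G v R)"
    (is "?response")
proof -
  define A where "A = M - insert v R"
  define l where "l = card (M \<inter> R)"
  define r where "r = card (R \<inter> verts G)"
  define a where "a I = sum_color_cost (delete_verts G (R \<union> I))" for I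
  define b where "b I = sum_color_cost (delete_verts G (insert v R \<union> I))" for I
  define d where "d I = excess (delete_verts G I) v R" for I
  define k where "k = tri_root (r + d {})"
  note S' = S[unfolded pendant_star_def]
  have fin: "finite (verts G)" using S' by (simp add: finite_simple_graph_def)
  then have finM: "finite M" using M finite_subset by blast
  have lr: "l \<le> r" unfolding l_def r_def using fin M by (intro card_mono) auto
  have cM: "card M = card A + l + (if v \<in> M then 1 else 0)"
  proof -
    have "M = A \<union> (M \<inter> R) \<union> (M \<inter> {v})" by (auto simp: A_def)
    then have "card M = card (A \<union> (M \<inter> R) \<union> (M \<inter> {v}))" by simp
    also have "\<dots> = card (A \<union> (M \<inter> R)) + card (M \<inter> {v})"
      using finM S' by (intro card_Un_disjoint) (auto simp: A_def)
    also have "card (A \<union> (M \<inter> R)) = card A + l"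
      unfolding l_def using finM by (intro card_Un_disjoint) (auto simp: A_def)
    finally show ?thesis by (cases "v \<in> M") auto
  qed
  have value_eq: "star_value G v R = b {} + r + 1 + k"
    by (simp add: star_value_def b_def r_def k_def d_def)
  have ab: "a I = Suc (b I + d I)" "d I \<le> 1" "w \<in> I \<Longrightarrow> d I = 0" if "v \<notin> I" for I
    using pendant_star_costs[OF pendant_star_delete_verts[OF S that]]
    by (auto simp: a_def b_def d_def Un_commute)
  have no_edge: "{x, y} \<notin> edges G" if "x \<in> R" "y \<noteq> v" for x y
    using S' that by blast
  \<comment> \<open>Keep \<open>v\<close> uncolored: the position remains a pendant star with r - l
    leaves, and \<open>le\<close> compares its value with the old one.\<close>
  have wait: ?response if I: "I \<subseteq> A" "independent_in G I"
    and le: "card M + (b I + (r - l) + 1 + tri_root (r - l + d I)) \<le> b {} + r + 1 + k" for I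
  proof (intro exI[of _ "I \<union> (M \<inter> R)"] conjI disjI2)
    let ?J = "I \<union> (M \<inter> R)"
    show "?J \<subseteq> M" using I(1) A_def by blast
    have vJ: "v \<notin> ?J" using I(1) S' A_def by blast
    have "{x, y} \<notin> edges G" if "x \<in> ?J" "y \<in> ?J" for x y
    proof -
      have "x \<noteq> v" "y \<noteq> v" using vJ that by blast+
      then show ?thesis
        using that I(2) no_edge[of x y] no_edge[of y x]
        by (auto simp: independent_in_def insert_commute)
    qed
    then show "independent_in G ?J" by (simp add: independent_in_def)
    show "pendant_star (delete_verts G ?J) v R w"
      using S vJ by (rule pendant_star_delete_verts)
    have "R \<inter> (verts G - ?J) = R \<inter> verts G - (M \<inter> R)" using I(1) by (auto simp: A_def)
    then have "card (R \<inter> (verts G - ?J)) = r - l"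
      using fin finM M unfolding r_def l_def by (simp, intro card_Diff_subset) auto
    moreover have "?J \<union> R = I \<union> R" "?J \<union> insert v R = I \<union> insert v R" by blast+
    ultimately have "star_value (delete_verts G ?J) v R
        = b I + (r - l) + 1 + tri_root (r - l + d I)"
      by (simp add: star_value_def b_def d_def excess_def Un_commute)
    then show "card M + star_value (delete_verts G ?J) v R \<le> star_value G v R"
      using le value_eq by simp
  qed
  \<comment> \<open>Color \<open>v\<close>: all r leaves, the marked ones included, stay behind as
    isolated vertices and cost one point each.\<close>
  have take: ?response if I: "I \<subseteq> A" "independent_in G (insert v I)" "v \<in> M"
    and le: "card M + (b I + r) \<le> b {} + r + 1 + k" for I
  proof (intro exI[of _ "insert v I"] conjI disjI1)
    show "insert v I \<subseteq> M" using I A_def by blast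
    show "independent_in G (insert v I)" by fact
    let ?H = "delete_verts G (insert v I)"
    have "{x, y} \<notin> edges ?H" if "x \<in> R" for x y
      using S' that by (auto simp: edges_delete_verts)
    then have "sum_color_cost ?H = sum_color_cost (delete_verts ?H R) + card (R \<inter> verts ?H)"
      using S' by (intro sum_color_cost_isolated_vertices) (auto simp: finite_simple_graph_delete_verts)
    moreover have "R \<inter> verts ?H = R \<inter> verts G" using I(1) S' A_def by auto
    ultimately have "sum_color_cost ?H = b I + r"
      by (simp add: b_def r_def Un_commute)
    then show "card M + sum_color_cost ?H \<le> star_value G v R"
      using le value_eq by simp
  qed
  have insert_v: "independent_in G (insert v I)" if "I \<subseteq> A" "independent_in G I" "w \<notin> I" for I
    using that S' A_def by (intro independent_in_insert) auto
  have opt_F: "\<exists>I\<subseteq>X. independent_in G I \<and> card X + a I \<le> a {}" if X: "X \<subseteq> insert v A" "X \<subseteq> M" for X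
  proof -
    have XV: "X \<subseteq> verts (delete_verts G R)" using X M S' A_def by auto
    obtain I where I: "I \<subseteq> X" "independent_in (delete_verts G R) I"
      "card X + sum_color_cost (delete_verts (delete_verts G R) I) \<le> sum_color_cost (delete_verts G R)"
      using optimal_response[OF _ XV] S' finite_simple_graph_delete_verts by metis
    moreover have "I \<inter> R = {}" using I(1) XV by auto
    ultimately show ?thesis by (auto simp: a_def independent_in_delete_verts)
  qed
  have opt_B: "\<exists>I\<subseteq>X. independent_in G I \<and> card X + b I \<le> b {}" if X: "X \<subseteq> A" for X
  proof -
    have XV: "X \<subseteq> verts (delete_verts G (insert v R))" using X M A_def by auto
    obtain I where I: "I \<subseteq> X" "independent_in (delete_verts G (insert v R)) I"
      "card X + sum_color_cost (delete_verts (delete_verts G (insert v R)) I)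
        \<le> sum_color_cost (delete_verts G (insert v R))"
      using optimal_response[OF _ XV] S' finite_simple_graph_delete_verts by metis
    moreover have "I \<inter> insert v R = {}" using I(1) XV by auto
    ultimately show ?thesis by (auto simp: b_def independent_in_delete_verts)
  qed
  have AM: "A \<subseteq> M" and vA: "v \<notin> A" by (auto simp: A_def)
  have opt_A: "\<exists>I\<subseteq>A. independent_in G I \<and> card A + b I + d I \<le> b {} + d {}"
    using opt_F[of A] AM vA ab(1) by (auto simp: subset_iff) (metis add_Suc_right add.assoc Suc_le_mono)
  \<comment> \<open>An answer that raises the excess from 0 to 1 may raise the root by 1, but an
    optimal answer in the graph with \<open>v\<close> saves \<open>d I\<close> points to
    compensate.\<close>
  have uu: "tri_root (r - l + d I) \<le> k + d I" if "d {} = 0" "v \<notin> I" for I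
    using ab(2)[OF that(2)] that(1) tri_root_mono[of "r - l" r] tri_root_Suc_le[of "r - l"]
    by (cases "d I") (auto simp: k_def)
  consider "v \<notin> M" "d {} = 0" | "v \<notin> M" "d {} = 1"
    | "v \<in> M" "d {} = 0" "l \<le> k" | "v \<in> M" "d {} = 0" "k < l"
    | "v \<in> M" "d {} = 1" "l < k" | "v \<in> M" "d {} = 1" "k \<le> l"
    using ab(2)[of "{}"] by fastforce
  then show ?thesis
  proof cases
    case 1
    obtain I where I: "I \<subseteq> A" "independent_in G I" "card A + b I + d I \<le> b {} + d {}"
      using opt_A by blast
    have "v \<notin> I" using I(1) vA by blast
    then show ?thesis using wait[OF I(1,2)] uu[of I] I(3) cM 1 lr by simp
  next
    case 2
    \<comment> \<open>The root in \<open>k\<close> already counts the excess 1, so an answer that is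
      optimal without \<open>v\<close> suffices whatever excess it leaves.\<close>
    obtain I where I: "I \<subseteq> A" "independent_in G I" "card A + b I \<le> b {}"
      using opt_B[of A] by blast
    have "v \<notin> I" using I(1) vA by blast
    then have "tri_root (r - l + d I) \<le> k"
      unfolding k_def using ab(2)[of I] 2 by (intro tri_root_mono) simp
    then show ?thesis using wait[OF I(1,2)] I(3) cM 2 lr by simp
  next
    case 3
    have cI: "card (insert v A) = Suc (card A)"
      using finM AM vA by (meson card_insert_disjoint finite_subset)
    \<comment> \<open>With excess 0, the optimal answer to the mark including \<open>v\<close>
      decides: if it colors \<open>v\<close>, l \<le> k makes that affordable; if not, its
      inequality already pays for marking \<open>v\<close>.\<close>
    obtain I where I: "I \<subseteq> insert v A" "independent_in G I" "card (insert v A) + a I \<le> a {}"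
      using opt_F[of "insert v A"] AM 3(1) by blast
    have a0: "a {} = Suc (b {})" using ab(1)[of "{}"] 3 by simp
    show ?thesis
    proof (cases "v \<in> I")
      case True
      have "independent_in G (insert v (I - {v}))" using I(2) True by (simp add: insert_absorb)
      moreover have "a I = b (I - {v})"
        using True by (auto simp: a_def b_def intro!: arg_cong[where f = "\<lambda>S. sum_color_cost (delete_verts G S)"])
      moreover have "I - {v} \<subseteq> A" using I(1) by blast
      ultimately show ?thesis using take[of "I - {v}"] I(3) cI a0 cM 3 by simp
    next
      case False
      have "I \<subseteq> A" using I(1) False by blast
      then show ?thesis using wait[of I] I(2,3) ab(1)[OF False] uu[OF 3(2) False] cI a0 cM 3 lr by simp
    qed
  next
    case 4
    obtain I where I: "I \<subseteq> A" "independent_in G I" "card A + b I + d I \<le> b {} + d {}"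
      using opt_A by blast
    have vI: "v \<notin> I" using I(1) vA by blast
    \<comment> \<open>More than k leaves are colored, and the resulting drop of the root pays for
      marking \<open>v\<close>.\<close>
    have "tri_root (r - l) < k"
      using tri_root_diff_less[of r l] 4 lr by (simp add: k_def)
    moreover have "tri_root (r - l + d I) \<le> tri_root (r - l) + d I"
      using ab(2)[OF vI] tri_root_Suc_le[of "r - l"] by (cases "d I") auto
    ultimately show ?thesis using wait[OF I(1,2)] I(3) cM 4 lr by simp
  next
    case 5
    txt \<open>Pretending that \<open>w\<close> is not marked costs at most one point and lets Painter color \<open>v\<close>.\<close>
    obtain I where I: "I \<subseteq> A - {w}" "independent_in G I" "card (A - {w}) + b I \<le> b {}"
      using opt_B[of "A - {w}"] by blast
    have "card A \<le> Suc (card (A - {w}))"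
      using finM AM by (cases "w \<in> A") (auto simp: card_Suc_Diff1 finite_subset)
    then show ?thesis using take[of I] insert_v[of I] I cM 5 by auto
  next
    case 6
    obtain I where I: "I \<subseteq> A" "independent_in G I" "card A + b I \<le> b {}"
      using opt_B[of A] by blast
    have vI: "v \<notin> I" using I(1) vA by blast
    show ?thesis
    proof (cases "l = k \<and> w \<notin> I")
      case True
      then show ?thesis using take[of I] insert_v[of I] I cM 6 by auto
    next
      case False
      have "tri_root (r - l + d I) < k"
      \<comment> \<open>If l = k, then \<open>w\<close> is colored and the excess falls to 0, which
        acts like one more colored leaf: the argument of the root falls from r + 1 by l + 1 > k. If
        l > k, the leaves alone make it fall by more than k.\<close>
      proof (cases "l = k")
        case True
        then have "d I = 0" using False ab(3)[OF vI] by blast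
        have "k > 0" unfolding k_def using tri_root_mono[of 1 "r + d {}"] 6 by simp
        then show ?thesis
          using tri_root_diff_less[of "r + 1" "Suc l"] 6 True lr \<open>d I = 0\<close> by (simp add: k_def)
      next
        case False
        have "tri_root (r - l + d I) \<le> tri_root (r + 1 - l)"
          using ab(2)[OF vI] lr by (intro tri_root_mono) simp
        also have "\<dots> < k"
          using tri_root_diff_less[of "r + 1" l] 6 False lr by (simp add: k_def)
        finally show ?thesis .
      qed
      then show ?thesis using wait[OF I(1,2)] I(3) cM 6 lr by simp
    qed
  qed
qed

section \<open>Upper and lower bounds for the cost of a star\<close>

lemma sum_color_cost_le_star_value:
  assumes "pendant_star G v R w"
  shows "sum_color_cost G \<le> star_value G v R"
  using assms
proof (rule sum_color_cost_le_potential[where P = "\<lambda>G. pendant_star G v R w"])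
  show "finite_simple_graph G" if "pendant_star G v R w" for G
    using that by (simp add: pendant_star_def)
qed (rule star_value_response)

text \<open>Lister marks \<open>v\<close> and k leaves. If Painter colors \<open>v\<close>, no
  marked leaf can be colored and every leaf costs a point later. Otherwise some leaves are colored,
  and induction applies to a smaller star with the same cost beyond it and the same excess; the
  point for \<open>v\<close> makes up for the root dropping by at most 1.\<close>

lemma star_value_le_sum_color_cost:
  assumes "pendant_star G v R w" "R \<subseteq> verts G" "\<And>x. x \<in> R \<Longrightarrow> {v, x} \<in> edges G"
  shows "star_value G v R \<le> sum_color_cost G"
  using assms
proof (induction "card R" arbitrary: G R rule: less_induct)
  case less
  note S = less.prems(1)[unfolded pendant_star_def]
  let ?b = "sum_color_cost (delete_verts G (insert v R))"
  define k where "k = tri_root (card R + excess G v R)"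
  have finR: "finite R"
    using S less.prems(2) by (auto simp: finite_simple_graph_def intro: finite_subset)
  have value_eq: "star_value G v R = ?b + card R + 1 + k"
    using less.prems(2) by (simp add: star_value_def k_def Int_absorb2)
  show ?case
  proof (cases "R = {}")
    case True
    \<comment> \<open>Without leaves the root is taken at an argument 0 or 1, where it is the
      identity, so the value is the cost by definition of the excess.\<close>
    have "k = excess G v R"
      using True pendant_star_costs(2)[OF less.prems(1)]
      by (cases "excess G v R") (auto simp: k_def)
    then show ?thesis
      using True value_eq pendant_star_costs(1)[OF less.prems(1)] by simp
  next
    case False
    then have "card R \<ge> 1" using finR by (simp add: Suc_leI card_gt_0_iff)
    \<comment> \<open>There must be k leaves to mark. With r \<ge> 1 leaves,
      \<open>tri (r + 1)\<close> \<ge> r + 2 exceeds r plus the excess.\<close>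
    have "k \<le> card R"
    proof (rule ccontr)
      assume "\<not> k \<le> card R"
      then have "tri (Suc (card R)) \<le> card R + excess G v R"
        using le_tri_root_iff[of "Suc (card R)" "card R + excess G v R"] unfolding k_def by linarith
      moreover have "tri (card R) \<ge> 1"
        using strict_mono_less_eq[OF strict_mono_tri, of 1] \<open>card R \<ge> 1\<close> by simp
      ultimately show False using pendant_star_costs(2)[OF less.prems(1)] by simp
    qed
    then obtain L where L: "L \<subseteq> R" "card L = k"
      by (meson obtain_subset_with_card_n)
    have vL: "v \<notin> L" "finite L" using L(1) S finR finite_subset by auto
    obtain I where I: "I \<subseteq> insert v L" "independent_in G I"
      "card (insert v L) + sum_color_cost (delete_verts G I) \<le> sum_color_cost G"
      using optimal_response[of G "insert v L"] S L(1) less.prems(2) by blast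
    have cL: "card (insert v L) = Suc k" using L(2) vL by simp
    show ?thesis
    proof (cases "v \<in> I")
      case True
      have "x \<notin> I" if "x \<in> R" for x
        using I(2) True less.prems(3)[OF that] by (auto simp: independent_in_def)
      then have "I = {v}" using I(1) L(1) True by blast
      have "sum_color_cost (delete_verts G {v})
          = sum_color_cost (delete_verts (delete_verts G {v}) R) + card (R \<inter> verts (delete_verts G {v}))"
        using S by (intro sum_color_cost_isolated_vertices)
          (auto simp: finite_simple_graph_delete_verts edges_delete_verts)
      moreover have "R \<inter> verts (delete_verts G {v}) = R" using S less.prems(2) by auto
      ultimately show ?thesis using I(3) cL \<open>I = {v}\<close> value_eq by simp
    next
      case False
      then have IL: "I \<subseteq> L" using I(1) by blast
      \<comment> \<open>An empty answer would make the cost exceed itself; a nonempty one makes the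
        leaf set strictly smaller for the induction.\<close>
      have "I \<noteq> {}" using I(3) cL by auto
      let ?H = "delete_verts G I"
      have cI: "card I \<le> k" using IL L(2) vL(2) card_mono by blast
      have cRI: "card (R - I) = card R - card I" "card I \<le> card R"
        using IL L(1) finR by (auto simp: card_Diff_subset finite_subset card_mono)
      have "card I > 0" using \<open>I \<noteq> {}\<close> IL vL(2) by (meson card_gt_0_iff finite_subset)
      then have "star_value ?H v (R - I) \<le> sum_color_cost ?H"
        using less.prems cRI False
        by (intro less.hyps)
          (auto simp: pendant_star_def finite_simple_graph_delete_verts edges_delete_verts)
      moreover have "star_value ?H v (R - I)
          = ?b + (card R - card I) + 1 + tri_root (card R - card I + excess G v R)"
      proof -
        have "I \<union> (R - I) = R" "I \<union> insert v (R - I) = insert v R" using IL L(1) by auto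
        moreover have "(R - I) \<inter> (verts G - I) = R - I" using less.prems(2) by auto
        ultimately show ?thesis
          by (simp add: star_value_def excess_def cRI)
      qed
      moreover have "k \<le> Suc (tri_root (card R - card I + excess G v R))"
      proof -
        have "k \<le> Suc (tri_root (card R + excess G v R - k))"
          unfolding k_def by (rule tri_root_diff_ge)
        also have "tri_root (card R + excess G v R - k) \<le> tri_root (card R - card I + excess G v R)"
          using cI cRI by (intro tri_root_mono) simp
        finally show ?thesis by simp
      qed
      ultimately show ?thesis using I(3) cL value_eq cI cRI by simp
    qed
  qed
qed

section \<open>From stems to the formula of the theorem\<close>

lemma stem_pendant_star:
  assumes G: "finite_simple_graph G" and "is_stem G v"
  obtains w where "pendant_star G v (leaf_nbrs G v) w"
proof -
  have fin: "finite (nbrs G v - leaf_nbrs G v)"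
    using G by (simp add: nbrs_def finite_simple_graph_def)
  have edge: "x \<in> verts G \<and> y \<in> verts G \<and> x \<noteq> y" if "{x, y} \<in> edges G" for x y
    using G that by (force simp: finite_simple_graph_def)
  have "\<forall>x\<in>nbrs G v - leaf_nbrs G v. \<forall>y\<in>nbrs G v - leaf_nbrs G v. x = y"
    using assms(2) card_le_Suc0_iff_eq[OF fin] by (simp add: is_stem_def)
  then have "\<exists>w. nbrs G v - leaf_nbrs G v \<subseteq> {w}" by blast
  then obtain w where w: "nbrs G v - leaf_nbrs G v \<subseteq> {w}" by blast
  have "y = v" if "x \<in> leaf_nbrs G v" "{x, y} \<in> edges G" for x y
  proof -
    have "card (nbrs G x) = 1" "{v, x} \<in> edges G"
      using that(1) by (auto simp: leaf_nbrs_def is_leaf_def nbrs_def)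
    moreover have "v \<in> nbrs G x" "y \<in> nbrs G x"
      using that(2) \<open>{v, x} \<in> edges G\<close> edge by (auto simp: nbrs_def insert_commute)
    ultimately show ?thesis by (metis card_1_singletonE singletonD)
  qed
  moreover have "v \<notin> leaf_nbrs G v"
    using edge[of v v] by (auto simp: leaf_nbrs_def nbrs_def)
  moreover have "y \<in> leaf_nbrs G v \<or> y = w" if "{v, y} \<in> edges G" for y
    using w that edge by (auto simp: nbrs_def)
  ultimately have "pendant_star G v (leaf_nbrs G v) w"
    using assms by (simp add: pendant_star_def is_stem_def)
  then show ?thesis by (rule that)
qed

theorem mainTheorem1:
  fixes T :: "'a sgraph"
  assumes "finite_forest T"
  shows "(edges T = {} \<longrightarrow> sum_color_cost T = card (verts T)) \<and>
    (\<forall>v R r. is_stem T v \<and> R = leaf_nbrs T v \<and> r = card R \<longrightarrow>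
       sum_color_cost T =
         (if \<not> triangular (r + 1)
          then sum_color_cost (delete_verts (delete_verts T R) {v}) + r + 1 + tri_root r
          else sum_color_cost (delete_verts T R) + r + tri_root r))"
proof (intro conjI impI allI)
  have T: "finite_simple_graph T" using assms by (simp add: finite_forest_def)
  show "sum_color_cost T = card (verts T)" if "edges T = {}"
    using sum_color_cost_isolated_vertices[OF T, of "verts T"] that
      sum_color_cost_empty[of "delete_verts T (verts T)"] finite_simple_graph_delete_verts[OF T]
    by simp
  fix v R r assume *: "is_stem T v \<and> R = leaf_nbrs T v \<and> r = card R"
  then obtain w where S: "pendant_star T v R w"
    using stem_pendant_star[OF T] by blast
  have R: "R \<subseteq> verts T" "\<And>x. x \<in> R \<Longrightarrow> {v, x} \<in> edges T"
    using * by (auto simp: leaf_nbrs_def nbrs_def)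
  have cost: "sum_color_cost T = sum_color_cost (delete_verts T (insert v R)) + r + 1 + tri_root (r + excess T v R)"
    using sum_color_cost_le_star_value[OF S] star_value_le_sum_color_cost[OF S R] R(1) *
    by (simp add: star_value_def Int_absorb2)
  \<comment> \<open>For excess 0 the two formulas agree, as deleting \<open>v\<close> costs exactly
    1. For excess 1 the root at r + 1 exceeds that at r exactly when r + 1 is triangular, and this
    extra point is absorbed by passing to the graph that keeps \<open>v\<close>.\<close>
  consider "excess T v R = 0" | "excess T v R = 1"
    using pendant_star_costs(2)[OF S] by linarith
  then show "sum_color_cost T =
         (if \<not> triangular (r + 1)
          then sum_color_cost (delete_verts (delete_verts T R) {v}) + r + 1 + tri_root r
          else sum_color_cost (delete_verts T R) + r + tri_root r)"
    by cases (use cost pendant_star_costs(1)[OF S] tri_root_Suc[of r] in simp_all)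
qed

end
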